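(* Let $I$ be a bounded closed interval, let $\mathbf{w}=(v,u)^\top$ be a smooth function on $I$ with $\mathbf{w}(x)\in\Sigma$ for all $x\in I$, and let $\mathbf{w}_h=(v_h,u_h)^\top$ be a vector of polynomials of degree $k$ on $I$ (an approximation of $\mathbf{w}$), with $v_h>0$ on $I$, which is not entirely contained in $\Sigma$ on $I$, and whose cell average $\bar{\mathbf{w}}_h=\frac1{|I|}\int_I\mathbf{w}_h(x)\,dx$ lies in $\Sigma_0$. Put $r_{\max}=\max_{x\in I}r(\mathbf{w}_h(x))$, $s_{\min}=\min_{x\in I}s(\mathbf{w}_h(x))$, and define the modified polynomial $$\tilde{\mathbf{w}}_h(x)=\theta\,\mathbf{w}_h(x)+(1-\theta)\,\bar{\mathbf{w}}_h,\qquad \theta=\min\{1,\theta_1,\theta_2\},$$ $$\theta_1=\frac{r_0-r(\bar{\mathbf{w}}_h)}{r_{\max}-r(\bar{\mathbf{w}}_h)},\qquad \theta_2=\frac{s(\bar{\mathbf{w}}_h)-s_0}{s(\bar{\mathbf{w}}_h)-s_{\min}}.$$ Then: (1) the cell average is preserved: $\frac1{|I|}\int_I\tilde{\mathbf{w}}_h(x)\,dx=\bar{\mathbf{w}}_h$; (2) $\tilde{\mathbf{w}}_h$ lies entirely within $\Sigma$, i.e. $r(\tilde{\mathbf{w}}_h(x))\le r_0$ and $s(\tilde{\mathbf{w}}_h(x))\ge s_0$ for all $x\in I$; (3) $\|\tilde{\mathbf{w}}_h-\mathbf{w}\|_\infty\le C\,\|\mathbf{w}_h-\mathbf{w}\|_\infty$,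 where $C>0$ is a constant depending only on $\bar{\mathbf{w}}_h$, $\mathbf{w}$ and the invariant region $\Sigma$ (the pressure law $p$ and the polynomial degree $k$ being fixed).
   Context: Pressure: $p:(0,\infty)\to(0,\infty)$ is smooth with $p'<0$, $p''>0$ and $\int_0^v\sqrt{-p'(\xi)}\,d\xi=\infty$ for all $v>0$. Initial data $v_0:\mathbb{R}\to(0,\infty)$, $u_0:\mathbb{R}\to\mathbb{R}$ are given with $m=\inf_x v_0(x)>0$. For $v>0$, $u\in\mathbb{R}$ set $g(v)=\int_m^v\sqrt{-p'(\xi)}\,d\xi$, $r(v,u)=u-g(v)$, $s(v,u)=u+g(v)$ (the Riemann invariants of the p-system $v_t-u_x=0$, $u_t+p(v)_x=0$). Let $r_0=\sup_x r(v_0(x),u_0(x))$ and $s_0=\inf_x s(v_0(x),u_0(x))$, assumed finite. The invariant region is $\Sigma=\{(v,u)^\top: v>0,\ r(v,u)\le r_0,\ s(v,u)\ge s_0\}$, and $\Sigma_0=\{(v,u)^\top: v>0,\ r(v,u)<r_0,\ s(v,u)>s_0\}$. The norm is $\|\mathbf{f}\|_\infty=\max_{x\in I}|\mathbf{f}(x)|$, with $|\cdot|$ the Euclidean norm. *)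

theory Defs
  imports "HOL-Analysis.Analysis" "HOL-Computational_Algebra.Polynomial"
begin

text \<open>
  Derivatives are taken within the set, so they are one-sided at the endpoints of a closed interval.
\<close>
definition smooth_within :: "real set \<Rightarrow> (real \<Rightarrow> 'a::real_normed_vector) \<Rightarrow> bool" where
  "smooth_within S f \<longleftrightarrow>
     (\<exists>D. D 0 = f \<and>
       (\<forall>n::nat. \<forall>x\<in>S. (D n has_vector_derivative D (Suc n) x) (at x within S)))"

definition pressure_law :: "(real \<Rightarrow> real) \<Rightarrow> bool" where
  "pressure_law p \<longleftrightarrow>
     smooth_within {0<..} p \<and>
     (\<forall>v>0. p v > 0 \<and> deriv p v < 0 \<and> deriv (deriv p) v > 0) \<and>
     (\<forall>v>0. (\<integral>\<^sup>+\<xi>\<in>{0<..<v}. ennreal (sqrt (- deriv p \<xi>)) \<partial>lborel) = \<infinity>)"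

text \<open>
  A state is a pair \<open>(v, u)\<close>; the product norm on \<^typ>\<open>real \<times> real\<close> is the Euclidean norm.
  The interval integral is signed: \<open>g p m v < 0\<close> for \<open>0 < v < m\<close>.
\<close>
definition g :: "(real \<Rightarrow> real) \<Rightarrow> real \<Rightarrow> real \<Rightarrow> real" where
  "g p m v = (LBINT \<xi>=m..v. sqrt (- deriv p \<xi>))"

definition riem_r :: "(real \<Rightarrow> real) \<Rightarrow> real \<Rightarrow> real \<times> real \<Rightarrow> real" where
  "riem_r p m w = snd w - g p m (fst w)"

definition riem_s :: "(real \<Rightarrow> real) \<Rightarrow> real \<Rightarrow> real \<times> real \<Rightarrow> real" where
  "riem_s p m w = snd w + g p m (fst w)"

definition inf_v :: "(real \<Rightarrow> real) \<Rightarrow> real" where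
  "inf_v v0 = (INF x. v0 x)"

definition r_bound :: "(real \<Rightarrow> real) \<Rightarrow> (real \<Rightarrow> real) \<Rightarrow> (real \<Rightarrow> real) \<Rightarrow> real" where
  "r_bound p v0 u0 = (SUP x. riem_r p (inf_v v0) (v0 x, u0 x))"

definition s_bound :: "(real \<Rightarrow> real) \<Rightarrow> (real \<Rightarrow> real) \<Rightarrow> (real \<Rightarrow> real) \<Rightarrow> real" where
  "s_bound p v0 u0 = (INF x. riem_s p (inf_v v0) (v0 x, u0 x))"

text \<open>
  The two boundedness conditions say that \<open>r_bound\<close> and \<open>s_bound\<close> are finite; without them
  the real-valued supremum and infimum would be unspecified.
\<close>
definition initial_data :: "(real \<Rightarrow> real) \<Rightarrow> (real \<Rightarrow> real) \<Rightarrow> (real \<Rightarrow> real) \<Rightarrow> bool" where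
  "initial_data p v0 u0 \<longleftrightarrow>
     (\<forall>x. v0 x > 0) \<and> inf_v v0 > 0 \<and>
     bdd_above (range (\<lambda>x. riem_r p (inf_v v0) (v0 x, u0 x))) \<and>
     bdd_below (range (\<lambda>x. riem_s p (inf_v v0) (v0 x, u0 x)))"

definition Sigma_region ::
    "(real \<Rightarrow> real) \<Rightarrow> (real \<Rightarrow> real) \<Rightarrow> (real \<Rightarrow> real) \<Rightarrow> (real \<times> real) set" where
  "Sigma_region p v0 u0 =
     {w. fst w > 0 \<and> riem_r p (inf_v v0) w \<le> r_bound p v0 u0
                   \<and> riem_s p (inf_v v0) w \<ge> s_bound p v0 u0}"

definition Sigma0_region ::
    "(real \<Rightarrow> real) \<Rightarrow> (real \<Rightarrow> real) \<Rightarrow> (real \<Rightarrow> real) \<Rightarrow> (real \<times> real) set" where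
  "Sigma0_region p v0 u0 =
     {w. fst w > 0 \<and> riem_r p (inf_v v0) w < r_bound p v0 u0
                   \<and> riem_s p (inf_v v0) w > s_bound p v0 u0}"

definition poly_vec :: "real poly \<Rightarrow> real poly \<Rightarrow> real \<Rightarrow> real \<times> real" where
  "poly_vec V U x = (poly V x, poly U x)"

definition cell_average :: "real \<Rightarrow> real \<Rightarrow> (real \<Rightarrow> real \<times> real) \<Rightarrow> real \<times> real" where
  "cell_average a b f = (1 / (b - a)) *\<^sub>R integral {a..b} f"

text \<open>
  Maxima and minima over \<open>{a..b}\<close> are written as suprema and infima; they are only used for
  functions that are continuous on the interval, where they are attained.
\<close>
definition sup_norm :: "real \<Rightarrow> real \<Rightarrow> (real \<Rightarrow> real \<times> real) \<Rightarrow> real" where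
  "sup_norm a b f = (SUP x\<in>{a..b}. norm (f x))"

definition limiter_theta1 ::
    "(real \<Rightarrow> real) \<Rightarrow> (real \<Rightarrow> real) \<Rightarrow> (real \<Rightarrow> real) \<Rightarrow> real \<Rightarrow> real \<Rightarrow> (real \<Rightarrow> real \<times> real) \<Rightarrow> real" where
  "limiter_theta1 p v0 u0 a b wh =
     (let r = riem_r p (inf_v v0); wbar = cell_average a b wh;
          r_max = (SUP x\<in>{a..b}. r (wh x))
      in (r_bound p v0 u0 - r wbar) / (r_max - r wbar))"

definition limiter_theta2 ::
    "(real \<Rightarrow> real) \<Rightarrow> (real \<Rightarrow> real) \<Rightarrow> (real \<Rightarrow> real) \<Rightarrow> real \<Rightarrow> real \<Rightarrow> (real \<Rightarrow> real \<times> real) \<Rightarrow> real" where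
  "limiter_theta2 p v0 u0 a b wh =
     (let s = riem_s p (inf_v v0); wbar = cell_average a b wh;
          s_min = (INF x\<in>{a..b}. s (wh x))
      in (s wbar - s_bound p v0 u0) / (s wbar - s_min))"

definition limiter_theta ::
    "(real \<Rightarrow> real) \<Rightarrow> (real \<Rightarrow> real) \<Rightarrow> (real \<Rightarrow> real) \<Rightarrow> real \<Rightarrow> real \<Rightarrow> (real \<Rightarrow> real \<times> real) \<Rightarrow> real" where
  "limiter_theta p v0 u0 a b wh =
     min 1 (min (limiter_theta1 p v0 u0 a b wh) (limiter_theta2 p v0 u0 a b wh))"

definition limited ::
    "(real \<Rightarrow> real) \<Rightarrow> (real \<Rightarrow> real) \<Rightarrow> (real \<Rightarrow> real) \<Rightarrow> real \<Rightarrow> real \<Rightarrow> (real \<Rightarrow> real \<times> real)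
       \<Rightarrow> real \<Rightarrow> real \<times> real" where
  "limited p v0 u0 a b wh x =
     (let \<theta> = limiter_theta p v0 u0 a b wh
      in \<theta> *\<^sub>R wh x + (1 - \<theta>) *\<^sub>R cell_average a b wh)"

end

theory Submission imports Defs begin

text \<open>
  Since \<open>p'' > 0\<close>, the integral \<open>g\<close> is strictly concave, so \<open>r\<close> is convex and \<open>s\<close> is concave.
  Membership of the limited polynomial in the region is convexity along the segment from the average.
  For the error, the limiter adds \<open>(1 - \<theta>) (wbar - wh)\<close>. If \<open>wh\<close> is far from \<open>w\<close>, the factor
  \<open>1 - \<theta> \<le> 1\<close> suffices. If \<open>wh\<close> is so close to \<open>w\<close> that \<open>vh\<close> stays away from the vacuum \<open>v = 0\<close>,
  then \<open>r\<close> is Lipschitz there, so \<open>wh\<close> overshoots the region by \<open>O(\<parallel>wh - w\<parallel>)\<close> and so does \<open>1 - \<theta>\<close>.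
  The denominators in \<open>\<theta>\<close> vanish only for constant \<open>wh\<close>, by the equality case of Jensen.
\<close>

section \<open>The slope \<open>sqrt (- deriv p v)\<close> of \<open>g\<close>\<close>

lemma pressure_law_deriv2:
  assumes "pressure_law p" "v > 0"
  shows "(deriv p has_real_derivative deriv (deriv p) v) (at v)"
proof -
  obtain D where D0: "D 0 = p"
    and D: "\<And>n x. x > 0 \<Longrightarrow> (D n has_vector_derivative D (Suc n) x) (at x within {0<..})"
    using assms(1) unfolding pressure_law_def smooth_within_def by auto
  have D': "(D n has_real_derivative D (Suc n) x) (at x)" if "x > 0" for n x
    using D[OF that, of n] that at_within_open[of x "{0<..}"]
    by (simp add: has_real_derivative_iff_has_vector_derivative)
  have d1: "deriv p x = D 1 x" if "x > 0" for x
    using D'[OF that, of 0] D0 by (simp add: DERIV_imp_deriv)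
  have "(D 1 has_real_derivative D 2 v) (at v)"
    using D'[OF assms(2), of 1] by (simp add: numeral_2_eq_2)
  \<comment> \<open>Derivatives within the open half-line are full derivatives, so
    \<open>D 1\<close> may be replaced by \<open>deriv p\<close> near \<open>v\<close>.\<close>
  hence "(deriv p has_real_derivative D 2 v) (at v)"
    by (rule has_field_derivative_transform_within_open[of _ _ _ "{0<..}"]) (use assms(2) d1 in auto)
  thus ?thesis by (simp add: DERIV_imp_deriv)
qed

lemma pressure_law_slope_strict_decreasing:
  assumes "pressure_law p" "0 < x" "x < y"
  shows "sqrt (- deriv p y) < sqrt (- deriv p x)"
proof -
  have "deriv p x < deriv p y"
  proof (rule DERIV_pos_imp_increasing[OF assms(3)])
    fix z assume "x \<le> z" "z \<le> y"
    hence "z > 0" using assms(2) by simp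
    thus "\<exists>d. (deriv p has_real_derivative d) (at z) \<and> d > 0"
      using pressure_law_deriv2[OF assms(1)] assms(1) unfolding pressure_law_def by blast
  qed
  thus ?thesis by simp
qed

lemma pressure_law_slope_pos:
  assumes "pressure_law p" "v > 0"
  shows "sqrt (- deriv p v) > 0"
  using assms unfolding pressure_law_def by simp

lemma g_has_real_derivative:
  assumes p: "pressure_law p" and "m > 0" "v > 0"
  shows "(g p m has_real_derivative sqrt (- deriv p v)) (at v)"
proof -
  \<comment> \<open>\<open>A\<close> and \<open>B\<close> put \<open>m\<close> and \<open>v\<close>
    inside a compact interval away from \<open>0\<close>; the fundamental theorem then covers
    \<open>v < m\<close> too and gives a two-sided derivative.\<close>
  define A where "A = min m v / 2"
  define B where "B = max m v + 1"
  have AB: "0 < A" "A < m" "A < v" "m < B" "v < B"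
    using assms(2,3) unfolding A_def B_def by auto
  have "continuous_on {A..B} (\<lambda>\<xi>. sqrt (- deriv p \<xi>))"
    by (intro continuous_on_real_sqrt continuous_on_minus continuous_at_imp_continuous_on)
       (use AB pressure_law_deriv2[OF p, THEN DERIV_isCont] in auto)
  hence "((\<lambda>u. LBINT y=m..u. sqrt (- deriv p y)) has_vector_derivative sqrt (- deriv p v))
      (at v within {A..B})"
    using AB by (intro interval_integral_FTC2) auto
  moreover have "at v within {A..B} = at v"
    using AB by (intro at_within_interior) auto
  ultimately show ?thesis
    unfolding g_def has_real_derivative_iff_has_vector_derivative by simp
qed

lemma continuous_on_g:
  assumes "pressure_law p" "m > 0"
  shows "continuous_on {0<..} (g p m)"
  using g_has_real_derivative[OF assms]
  by (intro continuous_at_imp_continuous_on) (auto intro: DERIV_isCont)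

section \<open>Strict concavity of \<open>g\<close>\<close>

text \<open>By the mean value theorem the chord has the slope of \<open>g\<close> at a point
  strictly between \<open>x\<close> and \<open>y\<close>. Slopes strictly decrease, so to the right
  of \<open>x\<close> the graph rises less than the tangent, and to the left it falls more.\<close>

lemma g_less_tangent:
  assumes p: "pressure_law p" and "m > 0" "x > 0" "y > 0" "x \<noteq> y"
  shows "g p m y < g p m x + sqrt (- deriv p x) * (y - x)"
proof (cases "x < y")
  case True
  obtain z where z: "x < z" "z < y" "g p m y - g p m x = (y - x) * sqrt (- deriv p z)"
    using MVT2[OF True, of "g p m" "\<lambda>z. sqrt (- deriv p z)"] g_has_real_derivative[OF p assms(2)]
      assms(3) by force
  have "(y - x) * sqrt (- deriv p z) < (y - x) * sqrt (- deriv p x)"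
    using pressure_law_slope_strict_decreasing[OF p assms(3) z(1)] True
    by (intro mult_strict_left_mono) auto
  thus ?thesis using z(3) by (simp add: mult.commute)
next
  case False
  hence yx: "y < x" using assms(5) by simp
  obtain z where z: "y < z" "z < x" "g p m x - g p m y = (x - y) * sqrt (- deriv p z)"
    using MVT2[OF yx, of "g p m" "\<lambda>z. sqrt (- deriv p z)"] g_has_real_derivative[OF p assms(2)]
      assms(4) by force
  have "z > 0" using z(1) assms(4) by simp
  hence "(x - y) * sqrt (- deriv p x) < (x - y) * sqrt (- deriv p z)"
    using pressure_law_slope_strict_decreasing[OF p _ z(2)] yx
    by (intro mult_strict_left_mono) auto
  thus ?thesis using z(3) by (simp add: algebra_simps)
qed

lemma g_le_tangent:
  assumes "pressure_law p" "m > 0" "x > 0" "y > 0"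
  shows "g p m y \<le> g p m x + sqrt (- deriv p x) * (y - x)"
  using g_less_tangent[OF assms] by (cases "x = y") auto

lemma convex_combination_pos:
  fixes x y t :: real
  assumes "x > 0" "y > 0" "0 \<le> t" "t \<le> 1"
  shows "t * x + (1 - t) * y > 0"
  using assms by (cases "t = 0") (auto intro!: add_pos_nonneg mult_pos_pos mult_nonneg_nonneg)

text \<open>Both values lie below the tangent at the intermediate point; in the weighted sum the
  linear terms cancel.\<close>

lemma g_concave:
  assumes p: "pressure_law p" and m: "m > 0" and x: "x > 0" and y: "y > 0" and t: "0 \<le> t" "t \<le> 1"
  shows "t * g p m x + (1 - t) * g p m y \<le> g p m (t * x + (1 - t) * y)"
proof -
  define z where "z = t * x + (1 - t) * y"
  define d where "d = sqrt (- deriv p z)"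
  have z: "z > 0" unfolding z_def using convex_combination_pos x y t by blast
  have "t * g p m x \<le> t * (g p m z + d * (x - z))"
    using g_le_tangent[OF p m z x] t unfolding d_def by (intro mult_left_mono) auto
  moreover have "(1 - t) * g p m y \<le> (1 - t) * (g p m z + d * (y - z))"
    using g_le_tangent[OF p m z y] t unfolding d_def by (intro mult_left_mono) auto
  moreover have "t * (g p m z + d * (x - z)) + (1 - t) * (g p m z + d * (y - z)) = g p m z"
    unfolding z_def by (simp add: algebra_simps)
  ultimately show ?thesis unfolding z_def by linarith
qed

text \<open>On \<open>v \<ge> c\<close> the slope of \<open>g\<close> is largest at
  \<open>c\<close>. Exchanging \<open>x\<close> and \<open>y\<close> gives the full Lipschitz
  bound.\<close>

lemma g_diff_le:
  assumes p: "pressure_law p" and m: "m > 0" and c: "0 < c" "c \<le> x" "c \<le> y"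
  shows "g p m y - g p m x \<le> sqrt (- deriv p c) * \<bar>y - x\<bar>"
proof -
  have pos: "x > 0" "y > 0" using c by auto
  have s: "sqrt (- deriv p x) \<le> sqrt (- deriv p c)"
    using pressure_law_slope_strict_decreasing[OF p c(1)] c(2) by (cases "c = x") (auto intro: less_imp_le simp del: real_sqrt_less_iff real_sqrt_le_iff)
  have "g p m y - g p m x \<le> sqrt (- deriv p x) * (y - x)"
    using g_le_tangent[OF p m pos] by simp
  also have "\<dots> \<le> sqrt (- deriv p x) * \<bar>y - x\<bar>"
    using pressure_law_slope_pos[OF p pos(1)] by (intro mult_left_mono) auto
  also have "\<dots> \<le> sqrt (- deriv p c) * \<bar>y - x\<bar>"
    using s by (intro mult_right_mono) auto
  finally show ?thesis .
qed

section \<open>Riemann invariants: convexity, Lipschitz bound, reflection\<close>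

lemma riem_r_convex:
  assumes "pressure_law p" "m > 0" "fst w > 0" "fst w' > 0" "0 \<le> t" "t \<le> 1"
  shows "riem_r p m (t *\<^sub>R w + (1 - t) *\<^sub>R w') \<le> t * riem_r p m w + (1 - t) * riem_r p m w'"
  using g_concave[OF assms] unfolding riem_r_def by (simp add: algebra_simps)

text \<open>The lower bound \<open>c\<close> keeps the states away from the vacuum, where the slope
  of \<open>g\<close> is unbounded.\<close>

lemma riem_r_diff_le:
  assumes "pressure_law p" "m > 0" "0 < c" "c \<le> fst w" "c \<le> fst w'"
  shows "riem_r p m w' - riem_r p m w \<le> (1 + sqrt (- deriv p c)) * norm (w' - w)"
proof -
  have n: "\<bar>fst w - fst w'\<bar> \<le> norm (w' - w)" "\<bar>snd w' - snd w\<bar> \<le> norm (w' - w)"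
    using norm_fst_le[of "fst w' - fst w" "snd w' - snd w"] norm_snd_le[of "snd w' - snd w" "fst w' - fst w"]
    by (auto simp: minus_prod_def abs_minus_commute)
  have "g p m (fst w) - g p m (fst w') \<le> sqrt (- deriv p c) * \<bar>fst w - fst w'\<bar>"
    using g_diff_le[OF assms(1,2,3,5,4)] .
  also have "\<dots> \<le> sqrt (- deriv p c) * norm (w' - w)"
    using n(1) pressure_law_slope_pos[OF assms(1,3)] by (intro mult_left_mono) auto
  finally show ?thesis using n(2) unfolding riem_r_def by (simp add: algebra_simps)
qed

lemma continuous_on_riem_r:
  assumes "pressure_law p" "m > 0" "continuous_on A f" "\<And>x. x \<in> A \<Longrightarrow> fst (f x) > 0"
  shows "continuous_on A (\<lambda>x. riem_r p m (f x))"
  unfolding riem_r_def using assms(3,4)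
  by (auto intro!: continuous_intros continuous_on_compose2[OF continuous_on_g[OF assms(1,2)]])

text \<open>Reflecting \<open>u\<close> turns a lower bound on \<open>s\<close> into an upper bound
  on \<open>r\<close>, so each estimate is proved for \<open>r\<close> only.\<close>

lemma riem_s_eq_riem_r: "riem_s p m w = - riem_r p m (fst w, - snd w)"
  unfolding riem_r_def riem_s_def by simp

section \<open>Cell averages and the strict Jensen inequality\<close>

lemma linear_integral_eq_cell_average:
  assumes "a < b" "continuous_on {a..b} f" "bounded_linear h"
  shows "integral {a..b} (\<lambda>x. h (f x)) = (b - a) *\<^sub>R h (cell_average a b f)"
proof -
  interpret h: bounded_linear h by fact
  have "integral {a..b} (h \<circ> f) = h (integral {a..b} f)"
    using assms by (intro integral_linear integrable_continuous_real)
  thus ?thesis using assms(1) unfolding cell_average_def by (simp add: o_def h.scaleR)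
qed

text \<open>
  This is Jensen's inequality, strict because the tangent plane of \<open>r\<close> at the average touches the
  graph of \<open>r\<close> only where \<open>v\<close> equals its average.
\<close>
lemma riem_r_cell_average_less_Sup:
  fixes f :: "real \<Rightarrow> real \<times> real"
  assumes p: "pressure_law p" and m: "m > 0" and ab: "a < b" and f: "continuous_on {a..b} f"
    and pos: "\<And>x. x \<in> {a..b} \<Longrightarrow> fst (f x) > 0" and pos0: "fst (cell_average a b f) > 0"
    and nonconst: "\<exists>x\<in>{a..b}. f x \<noteq> cell_average a b f"
  shows "riem_r p m (cell_average a b f) < (SUP x\<in>{a..b}. riem_r p m (f x))"
proof (rule ccontr)
  assume not_less: "\<not> ?thesis"
  define c where "c = cell_average a b f"
  define d where "d = sqrt (- deriv p (fst c))"
  \<comment> \<open>\<open>l\<close> is the linear part of the tangent plane: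
    \<open>riem_r p m w \<ge> riem_r p m c + l w - l c\<close> when \<open>fst w > 0\<close>. If
    \<open>r\<close> never exceeds its value at \<open>c\<close> along \<open>f\<close>, then
    \<open>l (f x) \<le> l c\<close> throughout.\<close>
  define l where "l w = snd w - d * fst w" for w :: "real \<times> real"
  have le: "riem_r p m (f x) \<le> riem_r p m c" if "x \<in> {a..b}" for x
  proof -
    have "bdd_above ((\<lambda>x. riem_r p m (f x)) ` {a..b})"
      by (intro compact_imp_bounded[THEN bounded_imp_bdd_above] compact_continuous_image
          continuous_on_riem_r p m f pos) auto
    from cSUP_upper[OF that this] not_less show ?thesis unfolding c_def by simp
  qed
  have tangent: "g p m (fst (f x)) \<le> g p m (fst c) + d * (fst (f x) - fst c)" if "x \<in> {a..b}" for x
    unfolding d_def c_def using pos0 pos[OF that] by (intro g_le_tangent p m)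
  have l_le: "0 \<le> l c - l (f x)" if "x \<in> {a..b}" for x
    using le[OF that] tangent[OF that] unfolding riem_r_def l_def by (simp add: algebra_simps)
  have bl: "bounded_linear l"
    unfolding l_def by (intro bounded_linear_intros)
  have cont: "continuous_on {a..b} (\<lambda>x. l c - l (f x))"
    using f unfolding l_def by (intro continuous_intros)
  have "integral {a..b} (\<lambda>x. l c - l (f x)) = integral {a..b} (\<lambda>x. l c) - integral {a..b} (\<lambda>x. l (f x))"
    by (intro integral_diff integrable_continuous_real continuous_intros)
       (use f in \<open>auto simp: l_def intro!: continuous_intros\<close>)
  also have "\<dots> = 0"
    using linear_integral_eq_cell_average[OF ab f bl] ab unfolding c_def by simp
  \<comment> \<open>A continuous nonnegative function with zero integral vanishes.\<close>
  finally have "\<forall>x\<in>{a..b}. l c - l (f x) = 0"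
    using integral_eq_0_iff[OF cont ab] l_le by blast
  hence l_eq: "l (f x) = l c" if "x \<in> {a..b}" for x using that by simp
  have "f x = c" if x: "x \<in> {a..b}" for x
  proof -
    have "fst c = fst (f x)"
    proof (rule ccontr)
      assume "fst c \<noteq> fst (f x)"
      hence "g p m (fst (f x)) < g p m (fst c) + d * (fst (f x) - fst c)"
        unfolding d_def c_def using pos0 pos[OF x] by (intro g_less_tangent p m)
      thus False using le[OF x] l_eq[OF x] unfolding riem_r_def l_def by (simp add: algebra_simps)
    qed
    thus ?thesis using l_eq[OF x] unfolding l_def by (simp add: prod_eq_iff)
  qed
  thus False using nonconst unfolding c_def by blast
qed

section \<open>Size of the limiting factor\<close>

text \<open>Convexity bounds \<open>r\<close> on the segment from \<open>c\<close> to
  \<open>f x\<close> by \<open>riem_r p m c + t * (M - riem_r p m c)\<close>; the bound on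
  \<open>t\<close> is exactly what keeps this below \<open>R\<close>.\<close>

lemma riem_r_le_of_small_theta:
  fixes f :: "real \<Rightarrow> real \<times> real"
  assumes p: "pressure_law p" and m: "m > 0" and f: "continuous_on {a..b} f"
    and pos: "\<And>x. x \<in> {a..b} \<Longrightarrow> fst (f x) > 0" and pos0: "fst c > 0"
    and M: "M = (SUP x\<in>{a..b}. riem_r p m (f x))" and less: "riem_r p m c < M"
    and t: "0 \<le> t" "t \<le> 1" "t \<le> (R - riem_r p m c) / (M - riem_r p m c)" and x: "x \<in> {a..b}"
  shows "riem_r p m (t *\<^sub>R f x + (1 - t) *\<^sub>R c) \<le> R"
proof -
  have "bdd_above ((\<lambda>x. riem_r p m (f x)) ` {a..b})"
    by (intro compact_imp_bounded[THEN bounded_imp_bdd_above] compact_continuous_image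
        continuous_on_riem_r p m f pos) auto
  hence fM: "riem_r p m (f x) \<le> M" unfolding M by (rule cSUP_upper[OF x])
  have "riem_r p m (t *\<^sub>R f x + (1 - t) *\<^sub>R c) \<le> t * riem_r p m (f x) + (1 - t) * riem_r p m c"
    using pos[OF x] pos0 t by (intro riem_r_convex p m)
  also have "\<dots> \<le> t * M + (1 - t) * riem_r p m c"
    using fM t by (intro add_right_mono mult_left_mono)
  also have "\<dots> = riem_r p m c + t * (M - riem_r p m c)" by algebra
  also have "\<dots> \<le> R" using t(3) less by (simp add: pos_le_divide_eq)
  finally show ?thesis .
qed

text \<open>The left side equals \<open>(M - R) / (M - q)\<close>. Its numerator is the overshoot of
  \<open>f\<close> beyond the region, at most Lipschitz constant times error because
  \<open>w\<close> stays inside.\<close>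

lemma one_minus_theta_le:
  fixes f w :: "real \<Rightarrow> real \<times> real"
  assumes p: "pressure_law p" and m: "m > 0" and ab: "a \<le> b" and c: "c > 0"
    and fc: "\<And>x. x \<in> {a..b} \<Longrightarrow> c \<le> fst (f x)" and wc: "\<And>x. x \<in> {a..b} \<Longrightarrow> c \<le> fst (w x)"
    and wR: "\<And>x. x \<in> {a..b} \<Longrightarrow> riem_r p m (w x) \<le> R"
    and e: "\<And>x. x \<in> {a..b} \<Longrightarrow> norm (f x - w x) \<le> e" and e0: "e \<ge> 0"
    and M: "M = (SUP x\<in>{a..b}. riem_r p m (f x))" and less: "q < M" and d: "0 < d" "d \<le> R - q"
  shows "1 - (R - q) / (M - q) \<le> (1 + sqrt (- deriv p c)) * e / d"
proof -
  define L where "L = 1 + sqrt (- deriv p c)"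
  have L: "L > 0" unfolding L_def by (intro add_pos_pos zero_less_one pressure_law_slope_pos[OF p c])
  have "M \<le> R + L * e" unfolding M
  proof (rule cSUP_least)
    fix x assume x: "x \<in> {a..b}"
    have "riem_r p m (f x) - riem_r p m (w x) \<le> L * norm (f x - w x)"
      unfolding L_def using riem_r_diff_le[OF p m c wc[OF x] fc[OF x]] .
    also have "\<dots> \<le> L * e" using e[OF x] L by simp
    finally show "riem_r p m (f x) \<le> R + L * e" using wR[OF x] by simp
  qed (use ab in simp)
  hence MR: "M - R \<le> L * e" by simp
  have eq: "1 - (R - q) / (M - q) = (M - R) / (M - q)" using less by (simp add: field_simps)
  show ?thesis
  \<comment> \<open>Only a positive overshoot guarantees \<open>M - q \<ge> d\<close>; otherwise the
    quotient is nonpositive.\<close>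
  proof (cases "M \<le> R")
    case True
    hence "(M - R) / (M - q) \<le> 0" using less by (simp add: divide_nonpos_pos)
    also have "0 \<le> L * e / d" using L e0 d by simp
    finally show ?thesis unfolding eq L_def .
  next
    case False
    hence "(M - R) / (M - q) \<le> (M - R) / d" using d less by (intro divide_left_mono) auto
    also have "\<dots> \<le> L * e / d" using MR d by (intro divide_right_mono) auto
    finally show ?thesis unfolding eq L_def .
  qed
qed

lemma cell_average_limited:
  assumes "a < b" "continuous_on {a..b} f"
  shows "cell_average a b (limited p v0 u0 a b f) = cell_average a b f"
proof -
  define t where "t = limiter_theta p v0 u0 a b f"
  define c where "c = cell_average a b f"
  have lim: "limited p v0 u0 a b f = (\<lambda>x. t *\<^sub>R f x + (1 - t) *\<^sub>R c)"
    unfolding limited_def t_def c_def Let_def by auto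
  have c: "integral {a..b} f = (b - a) *\<^sub>R c"
    unfolding c_def cell_average_def using assms(1) by simp
  have "integral {a..b} (\<lambda>x. t *\<^sub>R f x + (1 - t) *\<^sub>R c)
      = integral {a..b} (\<lambda>x. t *\<^sub>R f x) + integral {a..b} (\<lambda>x. (1 - t) *\<^sub>R c)"
    by (intro integral_add integrable_continuous_real continuous_intros assms(2))
  also have "\<dots> = (b - a) *\<^sub>R c"
    using assms(1) by (simp add: c algebra_simps)
  finally show ?thesis
    using assms(1) unfolding lim c_def[symmetric] by (simp add: cell_average_def)
qed

section \<open>The limiter: average, invariance and a uniform error constant\<close>

theorem theorem3p4:
  fixes p :: "real \<Rightarrow> real" and k :: nat and a b :: real
    and w :: "real \<Rightarrow> real \<times> real" and wbar :: "real \<times> real" and S :: "(real \<times> real) set"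
  assumes "pressure_law p"
    and "a < b"
    and "smooth_within {a..b} w"
    and "\<forall>x\<in>{a..b}. w x \<in> S"
  shows "\<exists>C>0. \<forall>v0 u0 V U.
    initial_data p v0 u0 \<and> Sigma_region p v0 u0 = S \<and>
    degree V \<le> k \<and> degree U \<le> k \<and>
    (\<forall>x\<in>{a..b}. poly V x > 0) \<and>
    \<not> (\<forall>x\<in>{a..b}. poly_vec V U x \<in> S) \<and>
    cell_average a b (poly_vec V U) = wbar \<and> wbar \<in> Sigma0_region p v0 u0
    \<longrightarrow>
    cell_average a b (limited p v0 u0 a b (poly_vec V U)) = wbar \<and>
    (\<forall>x\<in>{a..b}. limited p v0 u0 a b (poly_vec V U) x \<in> S) \<and>
    sup_norm a b (\<lambda>x. limited p v0 u0 a b (poly_vec V U) x - w x)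
      \<le> C * sup_norm a b (\<lambda>x. poly_vec V U x - w x)"
\<comment> \<open>\<open>C\<close> must be fixed before the initial data and the polynomials. If no
  data fit \<open>S\<close> and \<open>wbar\<close>, the claim is vacuous and any positive
  \<open>C\<close> serves.\<close>
proof (cases "\<exists>v0 u0. Sigma_region p v0 u0 = S \<and> wbar \<in> Sigma0_region p v0 u0")
  case False
  thus ?thesis by (intro exI[of _ 1]) auto
next
  case True
  then obtain v1 u1 where S1: "Sigma_region p v1 u1 = S" and wbar1: "wbar \<in> Sigma0_region p v1 u1"
    by blast
  \<comment> \<open>
    The distances of \<open>wbar\<close> to the boundary curves are measured along the \<open>u\<close>-direction inside \<open>S\<close>,
    so that they do not refer to the initial data that produce \<open>S\<close>.
  \<close>
  obtain d where d: "d > 0" "wbar + (0, d) \<in> S" "wbar - (0, d) \<in> S"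
  proof
    define d where "d = min (r_bound p v1 u1 - riem_r p (inf_v v1) wbar)
      (riem_s p (inf_v v1) wbar - s_bound p v1 u1)"
    show "d > 0" using wbar1 unfolding d_def Sigma0_region_def by simp
    thus "wbar + (0, d) \<in> S" "wbar - (0, d) \<in> S"
      using wbar1 d_def unfolding S1[symmetric] Sigma_region_def Sigma0_region_def
      by (auto simp: riem_r_def riem_s_def)
  qed
  have w_cont: "continuous_on {a..b} w"
    using assms(3) unfolding smooth_within_def continuous_on_eq_continuous_within
    by (metis has_vector_derivative_continuous)
  have w_pos: "fst (w x) > 0" if "x \<in> {a..b}" for x
    using assms(4) that unfolding S1[symmetric] Sigma_region_def by auto
  obtain x0 where x0: "x0 \<in> {a..b}" "\<And>x. x \<in> {a..b} \<Longrightarrow> fst (w x0) \<le> fst (w x)"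
    using continuous_attains_inf[OF compact_Icc _ continuous_on_fst[OF w_cont]] assms(2) by force
  \<comment> \<open>With half the minimum of \<open>v\<close>, an error below \<open>c\<close> still
    leaves \<open>vh \<ge> c\<close>.\<close>
  define c where "c = fst (w x0) / 2"
  have c: "c > 0" using w_pos[OF x0(1)] unfolding c_def by simp
  have wc: "2 * c \<le> fst (w x)" if "x \<in> {a..b}" for x using x0(2)[OF that] unfolding c_def by simp
  obtain M where M: "M > 0" "\<And>x. x \<in> {a..b} \<Longrightarrow> norm (wbar - w x) \<le> M"
  proof -
    have "bounded ((\<lambda>x. wbar - w x) ` {a..b})"
      by (intro compact_imp_bounded compact_continuous_image continuous_intros w_cont) auto
    thus thesis using that unfolding bounded_pos by auto
  qed
  define L where "L = 1 + sqrt (- deriv p c)"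
  have L: "L > 0" unfolding L_def by (intro add_pos_pos zero_less_one pressure_law_slope_pos[OF assms(1) c])
  \<comment> \<open>One unit pays for the error of \<open>wh\<close> itself. The rest bounds the
    correction: \<open>1 + M / c\<close> for errors of at least \<open>c\<close>,
    \<open>L * (M + c) / d\<close> for smaller ones.\<close>
  define C where "C = 2 + M / c + L * (M + c) / d"
  have C: "C > 0"
    unfolding C_def using M(1) c L d(1) by (intro add_pos_pos divide_pos_pos mult_pos_pos) auto
  show ?thesis
  proof (intro exI[of _ C] conjI C allI impI; elim conjE)
    fix v0 u0 :: "real \<Rightarrow> real" and V U :: "real poly"
    assume init: "initial_data p v0 u0" and S: "Sigma_region p v0 u0 = S"
      and V: "\<forall>x\<in>{a..b}. poly V x > 0" and out: "\<not> (\<forall>x\<in>{a..b}. poly_vec V U x \<in> S)"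
      and avg: "cell_average a b (poly_vec V U) = wbar" and wbar: "wbar \<in> Sigma0_region p v0 u0"
    define m where "m = inf_v v0"
    define f where "f = poly_vec V U"
    define R where "R = r_bound p v0 u0"
    define T where "T = s_bound p v0 u0"
    \<comment> \<open>With this reflection, \<open>S\<close> is cut out by two upper bounds on
      \<open>riem_r\<close>, and both halves of the limiter use the same lemmas.\<close>
    define rf where "rf w = (fst w, - snd w)" for w :: "real \<times> real"
    define t where "t = limiter_theta p v0 u0 a b f"
    have m: "m > 0" using init unfolding m_def initial_data_def by simp
    note p = assms(1) and ab = assms(2)
    have memS: "z \<in> S \<longleftrightarrow> fst z > 0 \<and> riem_r p m z \<le> R \<and> riem_r p m (rf z) \<le> - T" for z
      unfolding S[symmetric] Sigma_region_def m_def R_def T_def rf_def riem_s_eq_riem_r by auto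
    have wb: "fst wbar > 0" "riem_r p m wbar < R" "riem_r p m (rf wbar) < - T"
      using wbar unfolding Sigma0_region_def m_def R_def T_def rf_def riem_s_eq_riem_r by auto
    \<comment> \<open>Membership of the two shifted points in \<open>S\<close> transfers the gap
      \<open>d\<close> to the present data, whose \<open>m\<close>, \<open>R\<close>,
      \<open>T\<close> may differ from those that defined \<open>d\<close>.\<close>
    have dR: "d \<le> R - riem_r p m wbar" "d \<le> - T - riem_r p m (rf wbar)"
      using d(2,3) unfolding memS by (auto simp: riem_r_def rf_def)
    have f_cont: "continuous_on {a..b} f"
      unfolding f_def poly_vec_def by (intro continuous_intros)
    have f_pos: "fst (f x) > 0" if "x \<in> {a..b}" for x
      using V that unfolding f_def poly_vec_def by simp
    have avg: "cell_average a b f = wbar" using avg unfolding f_def .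
    have rf_lin: "bounded_linear rf"
      unfolding rf_def
      by (intro bounded_linear_Pair bounded_linear_fst bounded_linear_minus bounded_linear_snd)
    have rf_cont: "continuous_on {a..b} (\<lambda>x. rf (f x))"
      unfolding rf_def by (intro continuous_intros f_cont)
    have rf_avg: "cell_average a b (\<lambda>x. rf (f x)) = rf wbar"
      using linear_integral_eq_cell_average[OF ab f_cont rf_lin] ab avg
      by (simp add: cell_average_def)
    have rf_norm: "norm (rf y - rf z) = norm (y - z)" for y z
      unfolding rf_def norm_prod_def by (auto simp: power2_commute abs_minus_commute)
    obtain y where y: "y \<in> {a..b}" "f y \<notin> S" using out unfolding f_def by blast
    \<comment> \<open>Leaving \<open>S\<close> somewhere makes \<open>f\<close> nonconstant, as
      strict Jensen requires for positive denominators.\<close>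
    have y_ne: "f y \<noteq> wbar" using y(2) wb memS[of wbar] by auto
    define r_max where "r_max = (SUP x\<in>{a..b}. riem_r p m (f x))"
    define s_max where "s_max = (SUP x\<in>{a..b}. riem_r p m (rf (f x)))"
    have r_less: "riem_r p m wbar < r_max"
      unfolding r_max_def avg[symmetric]
      by (rule riem_r_cell_average_less_Sup[OF p m ab f_cont f_pos])
         (use y(1) y_ne wb avg in auto)
    have s_less: "riem_r p m (rf wbar) < s_max"
      unfolding s_max_def rf_avg[symmetric]
      by (rule riem_r_cell_average_less_Sup[OF p m ab rf_cont])
         (use f_pos wb y_ne y(1) rf_avg in \<open>auto simp: rf_def prod_eq_iff\<close>)
    define t1 where "t1 = (R - riem_r p m wbar) / (r_max - riem_r p m wbar)"
    define t2 where "t2 = (- T - riem_r p m (rf wbar)) / (s_max - riem_r p m (rf wbar))"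
    have s_max_eq: "(INF x\<in>{a..b}. riem_s p m (f x)) = - s_max"
      unfolding s_max_def riem_s_eq_riem_r rf_def by (simp add: Inf_real_def image_image)
    have "limiter_theta1 p v0 u0 a b f = t1"
      unfolding limiter_theta1_def t1_def r_max_def R_def m_def Let_def avg ..
    moreover have "limiter_theta2 p v0 u0 a b f = t2"
      unfolding limiter_theta2_def t2_def T_def Let_def avg m_def[symmetric] s_max_eq
      by (simp add: riem_s_eq_riem_r rf_def)
    ultimately have t_eq: "t = min 1 (min t1 t2)"
      unfolding t_def limiter_theta_def by simp
    have "t1 > 0" "t2 > 0" unfolding t1_def t2_def using r_less s_less wb by auto
    hence t: "0 \<le> t" "t \<le> 1" "t \<le> t1" "t \<le> t2" unfolding t_eq by auto
    have lim: "limited p v0 u0 a b f x = t *\<^sub>R f x + (1 - t) *\<^sub>R wbar" for x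
      unfolding limited_def t_def Let_def avg ..
    show "cell_average a b (limited p v0 u0 a b (poly_vec V U)) = wbar"
      using cell_average_limited[OF ab f_cont] avg unfolding f_def by simp
    show "\<forall>x\<in>{a..b}. limited p v0 u0 a b (poly_vec V U) x \<in> S"
      unfolding f_def[symmetric]
    proof
      fix x assume x: "x \<in> {a..b}"
      have "fst (limited p v0 u0 a b f x) > 0"
        unfolding lim using convex_combination_pos[OF f_pos[OF x] wb(1) t(1,2)] by simp
      moreover have "riem_r p m (limited p v0 u0 a b f x) \<le> R"
        unfolding lim
        by (rule riem_r_le_of_small_theta[OF p m f_cont f_pos wb(1) r_max_def r_less t(1,2) _ x])
           (use t(3) in \<open>auto simp: t1_def\<close>)
      moreover have "riem_r p m (t *\<^sub>R rf (f x) + (1 - t) *\<^sub>R rf wbar) \<le> - T"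
        by (rule riem_r_le_of_small_theta[OF p m rf_cont _ _ s_max_def s_less t(1,2) _ x])
           (use t(4) f_pos wb(1) in \<open>auto simp: t2_def rf_def\<close>)
      moreover have "rf (limited p v0 u0 a b f x) = t *\<^sub>R rf (f x) + (1 - t) *\<^sub>R rf wbar"
        unfolding lim rf_def by simp
      ultimately show "limited p v0 u0 a b f x \<in> S" unfolding memS by simp
    qed
    define e where "e = sup_norm a b (\<lambda>x. f x - w x)"
    have e: "norm (f x - w x) \<le> e" if "x \<in> {a..b}" for x
      unfolding e_def sup_norm_def
      by (intro cSUP_upper[OF that] bounded_imp_bdd_above compact_imp_bounded
          compact_continuous_image continuous_intros f_cont w_cont) auto
    have e0: "e \<ge> 0" using e[OF x0(1)] norm_ge_zero order_trans by blast
    \<comment> \<open>The limiter changes \<open>f x\<close> by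
      \<open>(1 - t) *\<^sub>R (wbar - f x)\<close>, and \<open>M + e\<close> bounds the distance
      from \<open>wbar\<close> to \<open>f x\<close> by passing through \<open>w x\<close>.\<close>
    have key: "(1 - t) * (M + e) \<le> (C - 1) * e"
    proof (cases "c \<le> e")
      case True
      have "(1 - t) * (M + e) \<le> 1 * (M + e)" using t M e0 by (intro mult_right_mono) auto
      also have "\<dots> \<le> (M / c + 1) * e"
        using True M(1) c by (simp add: field_simps)
      also have "\<dots> \<le> (C - 1) * e"
        using e0 L M(1) c d(1) unfolding C_def by (intro mult_right_mono) auto
      finally show ?thesis .
    next
      case False
      have fc: "c \<le> fst (f x)" if "x \<in> {a..b}" for x
        using wc[OF that] e[OF that] norm_fst_le[of "fst (f x) - fst (w x)" "snd (f x) - snd (w x)"] False by (auto simp: minus_prod_def)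
      have wc': "c \<le> fst (w x)" if "x \<in> {a..b}" for x using wc[OF that] c by simp
      have wS: "riem_r p m (w x) \<le> R" "riem_r p m (rf (w x)) \<le> - T" if "x \<in> {a..b}" for x
        using assms(4) that memS by blast+
      have "1 - t1 \<le> L * e / d"
        unfolding t1_def L_def
        by (rule one_minus_theta_le[OF p m _ c fc wc' wS(1) e e0 r_max_def r_less d(1) dR(1)])
           (use ab in auto)
      moreover have "1 - t2 \<le> L * e / d"
        unfolding t2_def L_def
        by (rule one_minus_theta_le[OF p m _ c _ _ wS(2) _ e0 s_max_def s_less d(1) dR(2)])
           (use ab fc wc' e in \<open>auto simp: rf_norm\<close>, auto simp: rf_def)
      moreover have "0 \<le> L * e / d" using L e0 d(1) by simp
      ultimately have "1 - t \<le> L * e / d" unfolding t_eq by auto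
      \<comment> \<open>The factor \<open>1 - t\<close> already supplies one power of
        \<open>e\<close>; in the other factor \<open>e < c\<close> suffices.\<close>
      hence "(1 - t) * (M + e) \<le> (L * e / d) * (M + c)"
        using False M(1) e0 t L d(1) by (intro mult_mono) auto
      also have "\<dots> = (L * (M + c) / d) * e" by simp
      also have "\<dots> \<le> (C - 1) * e"
        using e0 M(1) c unfolding C_def by (intro mult_right_mono) auto
      finally show ?thesis .
    qed
    have "norm (limited p v0 u0 a b f x - w x) \<le> C * e" if x: "x \<in> {a..b}" for x
    proof -
      have "limited p v0 u0 a b f x - w x = (f x - w x) + (1 - t) *\<^sub>R ((wbar - w x) - (f x - w x))"
        unfolding lim by (simp add: algebra_simps)
      hence "norm (limited p v0 u0 a b f x - w x)
          \<le> norm (f x - w x) + norm ((1 - t) *\<^sub>R ((wbar - w x) - (f x - w x)))"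
        by (metis norm_triangle_ineq)
      also have "norm ((1 - t) *\<^sub>R ((wbar - w x) - (f x - w x)))
          = (1 - t) * norm ((wbar - w x) - (f x - w x))"
        using t(2) by simp
      also have "\<dots> \<le> (1 - t) * (M + e)"
        using norm_triangle_ineq4[of "wbar - w x" "f x - w x"] M(2)[OF x] e[OF x] t(2)
        by (intro mult_left_mono) auto
      also note key
      also have "norm (f x - w x) + (C - 1) * e \<le> C * e" using e[OF x] by (simp add: algebra_simps)
      finally show ?thesis by simp
    qed
    thus "sup_norm a b (\<lambda>x. limited p v0 u0 a b (poly_vec V U) x - w x)
        \<le> C * sup_norm a b (\<lambda>x. poly_vec V U x - w x)"
      unfolding f_def[symmetric] e_def[symmetric] unfolding sup_norm_def
      using ab by (intro cSUP_least) auto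
  qed
qed

end
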